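(* Let $k\ge 2$ and let $\tau_k$ be a task with $k-1$ higher-priority tasks $\tau_1,\dots,\tau_{k-1}$. Suppose a $k$-point effective schedulability test for $\tau_k$ under a given fixed-priority scheduling algorithm is given, with points $0<t_1\le t_2\le\cdots\le t_k$ and parameters $C_k>0$, $0<U_i\le 1$, $\alpha_i$, $\beta_i$ ($1\le i\le k-1$), and suppose that $\alpha,\beta$ are real numbers with $0<\alpha_i\le\alpha$ and $0<\beta_i\le\beta$ for all $i=1,\dots,k-1$. Then $\tau_k$ is schedulable by the scheduling algorithm if $$\beta\sum_{i=1}^{k-1}U_i\le\ln\left(\frac{\frac{\alpha}{\beta}+1}{\frac{C_k}{t_k}+\frac{\alpha}{\beta}}\right).$$
   Context: A $k$-point effective schedulability test is a sufficient schedulability test for $\tau_k$ under a fixed-priority scheduling policy that, for given $0<t_1\le t_2\le\cdots\le t_k$, verifies the existence of an index $j\in\{1,\dots,k\}$ such that $$C_k+\sum_{i=1}^{k-1}\alpha_i t_iU_i+\sum_{i=1}^{j-1}\beta_i t_iU_i\le t_j,$$ where $C_k>0$, $\alpha_i>0$, $U_i>0$, $\beta_i>0$ are constants depending on the task model and on task $\tau_i$. "Sufficient" means: if such an index $j$ exists, then $\tau_k$ is schedulable (all its jobs meet their deadlines) under the policy. It is assumed throughout that $0<U_i\le 1$. *)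

theory Defs
  imports Complex_Main "HOL-Library.Extended_Real"
begin

text \<open>
  The task model (sporadic, multiframe, self-suspending, one or several processors, ...) is left
  open. A task model together with a scheduling policy is represented by the set of all runs that
  can arise from them. In a run, \<open>contending\<close> says that a job competes for processor time at an
  instant; the model decides this, so a job may be pending without contending, for instance while
  it is self-suspended or while a non-preemptible section of another job occupies the processor.
  A job that never completes has \<open>finish\<close> equal to \<open>\<infinity>\<close>.
\<close>

record ('t, 'j) run =
  jobs :: "'j set"
  task_of :: "'j \<Rightarrow> 't"
  arrival :: "'j \<Rightarrow> real"
  deadline :: "'j \<Rightarrow> real"  \<comment> \<open>absolute deadline\<close>
  finish :: "'j \<Rightarrow> ereal"
  contending :: "'j \<Rightarrow> real \<Rightarrow> bool"
  executing :: "'j \<Rightarrow> real \<Rightarrow> bool"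

definition run_of :: "'t set \<Rightarrow> ('t, 'j) run \<Rightarrow> bool" where
  "run_of T r \<longleftrightarrow>
     (\<forall>j\<in>jobs r. task_of r j \<in> T) \<and>
     (\<forall>j\<in>jobs r. \<forall>x. executing r j x \<longrightarrow> contending r j x) \<and>
     (\<forall>j\<in>jobs r. \<forall>x. contending r j x \<longrightarrow> arrival r j \<le> x \<and> ereal x < finish r j)"

text \<open>
  Priorities belong to tasks, not to jobs, and larger values mean higher priority. A job that
  competes for the processor without obtaining it is never passed over in favour of a job of a
  lower-priority task. Ties may be broken arbitrarily.
\<close>

definition respects_priorities :: "('t \<Rightarrow> 'p::linorder) \<Rightarrow> ('t, 'j) run \<Rightarrow> bool" where
  "respects_priorities prio r \<longleftrightarrow>
     (\<forall>x. \<forall>j\<in>jobs r. \<forall>j'\<in>jobs r.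
        contending r j x \<and> \<not> executing r j x \<and> executing r j' x \<longrightarrow>
        prio (task_of r j) \<le> prio (task_of r j'))"

definition fixed_priority_policy ::
  "'t set \<Rightarrow> ('t \<Rightarrow> 'p::linorder) \<Rightarrow> ('t, 'j) run set \<Rightarrow> bool" where
  "fixed_priority_policy T prio policy \<longleftrightarrow>
     (\<forall>r\<in>policy. run_of T r \<and> respects_priorities prio r)"

definition higher_priority_tasks :: "'t set \<Rightarrow> ('t \<Rightarrow> 'p::linorder) \<Rightarrow> 't \<Rightarrow> 't set" where
  "higher_priority_tasks T prio s = {s'\<in>T. prio s < prio s'}"

definition schedulable :: "('t, 'j) run set \<Rightarrow> 't \<Rightarrow> bool" where
  "schedulable policy s \<longleftrightarrow>
     (\<forall>r\<in>policy. \<forall>j\<in>jobs r. task_of r j = s \<longrightarrow> finish r j \<le> ereal (deadline r j))"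

definition test_succeeds_at ::
  "nat \<Rightarrow> (nat \<Rightarrow> real) \<Rightarrow> real \<Rightarrow> (nat \<Rightarrow> real) \<Rightarrow> (nat \<Rightarrow> real) \<Rightarrow> (nat \<Rightarrow> real) \<Rightarrow> nat \<Rightarrow> bool"
where
  "test_succeeds_at k t C U \<alpha> \<beta> j \<longleftrightarrow>
     C + (\<Sum>i=1..k - 1. \<alpha> i * t i * U i) + (\<Sum>i=1..j - 1. \<beta> i * t i * U i) \<le> t j"

definition k_point_effective_test ::
  "('t, 'j) run set \<Rightarrow> 't \<Rightarrow> nat \<Rightarrow> (nat \<Rightarrow> real) \<Rightarrow> real \<Rightarrow>
   (nat \<Rightarrow> real) \<Rightarrow> (nat \<Rightarrow> real) \<Rightarrow> (nat \<Rightarrow> real) \<Rightarrow> bool" where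
  "k_point_effective_test policy s k t C U \<alpha> \<beta> \<longleftrightarrow>
     0 < t 1 \<and> (\<forall>i\<in>{1..k - 1}. t i \<le> t (i + 1)) \<and>
     0 < C \<and> (\<forall>i\<in>{1..k - 1}. 0 < \<alpha> i \<and> 0 < U i \<and> 0 < \<beta> i) \<and>
     ((\<exists>j\<in>{1..k}. test_succeeds_at k t C U \<alpha> \<beta> j) \<longrightarrow> schedulable policy s)"

end

theory Submission
  imports Defs
begin

text \<open>
  Suppose that the test fails at every point. Replacing all coefficients by \<open>\<alpha>\<close> and \<open>\<beta>\<close>, the demand
  \<open>S\<^sub>j = C + \<alpha> \<Sum>\<^sub>i t\<^sub>i U\<^sub>i + \<beta> \<Sum>\<^bsub>i<j\<^esub> t\<^sub>i U\<^sub>i\<close> exceeds \<open>t\<^sub>j\<close>, so each step multiplies it by at most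
  \<open>1 + \<beta> U\<^sub>j \<le> exp (\<beta> U\<^sub>j)\<close>, whence \<open>S\<^sub>k \<le> S\<^sub>1 exp (\<beta> \<Sum>\<^sub>i U\<^sub>i)\<close>. On the other hand
  \<open>(1 + \<alpha>/\<beta>) S\<^sub>1 = C + (\<alpha>/\<beta>) S\<^sub>k\<close>. Eliminating \<open>S\<^sub>1\<close> and using \<open>t\<^sub>k < S\<^sub>k\<close> bounds \<open>exp (\<beta> \<Sum>\<^sub>i U\<^sub>i)\<close>
  strictly from below by the argument of the logarithm.
\<close>

text \<open>Induction on \<open>n\<close>: the second hypothesis at the new index bounds
  \<open>t (Suc n)\<close> by the partial sum built so far, so that sum grows at most by the factor
  \<open>1 + \<beta> * U (Suc n)\<close>.\<close>

lemma discrete_gronwall_exp: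
  fixes t U :: "nat \<Rightarrow> real" and A \<beta> :: real
  assumes "\<And>i. i \<in> {1..n} \<Longrightarrow> 0 \<le> \<beta> * U i"
    and "\<And>i. i \<in> {1..n} \<Longrightarrow> t i \<le> A + \<beta> * (\<Sum>l=1..i - 1. t l * U l)"
    and "0 \<le> A"
  shows "A + \<beta> * (\<Sum>i=1..n. t i * U i) \<le> A * exp (\<beta> * (\<Sum>i=1..n. U i))"
  using assms(1,2)
proof (induction n)
  case 0
  then show ?case by simp
next
  case (Suc n)
  let ?S = "A + \<beta> * (\<Sum>i=1..n. t i * U i)"
  have IH: "?S \<le> A * exp (\<beta> * (\<Sum>i=1..n. U i))"
    using Suc by simp
  have nonneg: "0 \<le> \<beta> * U (Suc n)"
    using Suc.prems(1)[of "Suc n"] by simp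
  have "A + \<beta> * (\<Sum>i=1..Suc n. t i * U i) = ?S + t (Suc n) * (\<beta> * U (Suc n))"
    by (simp add: algebra_simps)
  also have "\<dots> \<le> ?S + ?S * (\<beta> * U (Suc n))"
    using Suc.prems(2)[of "Suc n"] nonneg by (intro add_left_mono mult_right_mono) auto
  also have "\<dots> = ?S * (1 + \<beta> * U (Suc n))"
    by (simp add: algebra_simps)
  \<comment> \<open>Here \<open>1 + x \<le> exp x\<close>; \<open>0 \<le> A\<close> makes the bound
    from the induction hypothesis nonnegative, as multiplying the inequalities requires.\<close>
  also have "\<dots> \<le> (A * exp (\<beta> * (\<Sum>i=1..n. U i))) * exp (\<beta> * U (Suc n))"
    using IH nonneg \<open>0 \<le> A\<close>
    by (intro mult_mono) (auto intro: exp_ge_add_one_self)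
  also have "\<dots> = A * exp (\<beta> * (\<Sum>i=1..Suc n. U i))"
    by (simp add: exp_add algebra_simps)
  finally show ?case .
qed

text \<open>The arithmetical core: scheduling enters only later, through the sufficiency clause of
  \<open>k_point_effective_test\<close>.\<close>

lemma test_succeeds_if_log_bound:
  fixes t U \<alpha>s \<beta>s :: "nat \<Rightarrow> real" and C \<alpha> \<beta> :: real
  assumes "2 \<le> k"
    and "0 < t 1"
    and incr: "\<And>i. i \<in> {1..k - 1} \<Longrightarrow> t i \<le> t (i + 1)"
    and "0 < C"
    and U: "\<And>i. i \<in> {1..k - 1} \<Longrightarrow> 0 < U i"
    and \<alpha>s: "\<And>i. i \<in> {1..k - 1} \<Longrightarrow> 0 < \<alpha>s i \<and> \<alpha>s i \<le> \<alpha>"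
    and \<beta>s: "\<And>i. i \<in> {1..k - 1} \<Longrightarrow> 0 < \<beta>s i \<and> \<beta>s i \<le> \<beta>"
    and bound: "\<beta> * (\<Sum>i=1..k - 1. U i) \<le> ln ((\<alpha> / \<beta> + 1) / (C / t k + \<alpha> / \<beta>))"
  shows "\<exists>j\<in>{1..k}. test_succeeds_at k t C U \<alpha>s \<beta>s j"
proof (rule ccontr)
  assume "\<not> ?thesis"
  then have fail: "t j < C + (\<Sum>i=1..k - 1. \<alpha>s i * t i * U i) + (\<Sum>i=1..j - 1. \<beta>s i * t i * U i)"
    if "j \<in> {1..k}" for j
    using that by (auto simp: test_succeeds_at_def not_le)
  have pos: "0 < t i" if "i \<in> {1..k}" for i
  proof -
    have "1 \<le> i" "i \<le> k" using that by auto
    then show ?thesis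
    proof (induction i rule: dec_induct)
      case base
      then show ?case using \<open>0 < t 1\<close> by simp
    next
      case (step n)
      then show ?case using incr[of n] by fastforce
    qed
  qed
  \<comment> \<open>Since \<open>2 \<le> k\<close>, index 1 carries positive coefficients below
    \<open>\<alpha>\<close> and \<open>\<beta>\<close>.\<close>
  have "0 < \<alpha>" "0 < \<beta>"
    using \<alpha>s[of 1] \<beta>s[of 1] \<open>2 \<le> k\<close> by force+
  define r where "r = \<alpha> / \<beta>"
  define P where "P = (\<Sum>i=1..k - 1. t i * U i)"
  define A where "A = C + \<alpha> * P"
  define S where "S = A + \<beta> * P"
  define E where "E = exp (\<beta> * (\<Sum>i=1..k - 1. U i))"
  have "0 < r"
    unfolding r_def using \<open>0 < \<alpha>\<close> \<open>0 < \<beta>\<close> by simp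
  have "0 < t k"
    using pos \<open>2 \<le> k\<close> by auto
  have "0 \<le> P"
    unfolding P_def using pos U by (intro sum_nonneg mult_nonneg_nonneg) (auto intro: less_imp_le)
  then have "0 < A"
    unfolding A_def using \<open>0 < C\<close> \<open>0 < \<alpha>\<close> by (simp add: add_pos_nonneg)
  have coeff_mono: "(\<Sum>i=1..n. c i * t i * U i) \<le> d * (\<Sum>i=1..n. t i * U i)"
    if "n \<le> k - 1" and "\<And>i. i \<in> {1..k - 1} \<Longrightarrow> c i \<le> d" for n c d
    unfolding sum_distrib_left mult.assoc using that pos U
    by (intro sum_mono mult_right_mono mult_nonneg_nonneg) (auto intro: less_imp_le)
  have fail': "t j < A + \<beta> * (\<Sum>i=1..j - 1. t i * U i)" if "j \<in> {1..k}" for j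
    using fail[OF that] coeff_mono[of "k - 1" \<alpha>s \<alpha>] coeff_mono[of "j - 1" \<beta>s \<beta>] that \<alpha>s \<beta>s
    unfolding A_def P_def by fastforce
  have "t k < S"
    using fail'[of k] \<open>2 \<le> k\<close> by (simp add: S_def P_def)
  have "S \<le> A * E"
    unfolding S_def P_def E_def
  proof (rule discrete_gronwall_exp)
    show "0 \<le> \<beta> * U i" if "i \<in> {1..k - 1}" for i
      using U[OF that] \<open>0 < \<beta>\<close> by simp
    show "t i \<le> A + \<beta> * (\<Sum>l=1..i - 1. t l * U l)" if "i \<in> {1..k - 1}" for i
      using that by (intro less_imp_le fail') auto
  qed (use \<open>0 < A\<close> in simp)
  \<comment> \<open>Because \<open>\<alpha> * P = r * (\<beta> * P)\<close>; this is what eliminates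
    \<open>A\<close> from \<open>S \<le> A * E\<close>.\<close>
  have "(1 + r) * A = C + r * S"
    unfolding S_def A_def r_def using \<open>0 < \<beta>\<close> by (simp add: field_simps)
  have "(r + 1) * S \<le> (C + r * S) * E"
    using mult_left_mono[OF \<open>S \<le> A * E\<close>, of "1 + r"] \<open>0 < r\<close> \<open>(1 + r) * A = C + r * S\<close>
    by (simp add: add.commute mult.assoc[symmetric])
  then have "r + 1 \<le> (C / S + r) * E"
    using \<open>0 < t k\<close> \<open>t k < S\<close> by (simp add: field_simps)
  \<comment> \<open>Failure at the last point, \<open>t k < S\<close>, makes the bound strict, which
    is what contradicts the non-strict \<open>bound\<close>.\<close>
  also have "\<dots> < (C / t k + r) * E"
    using \<open>0 < t k\<close> \<open>t k < S\<close> \<open>0 < C\<close> by (simp add: E_def divide_strict_left_mono)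
  finally have "(r + 1) / (C / t k + r) < E"
    using \<open>0 < t k\<close> \<open>0 < C\<close> \<open>0 < r\<close> by (simp add: pos_divide_less_eq add_pos_pos mult.commute)
  moreover have "0 < (r + 1) / (C / t k + r)"
    using \<open>0 < t k\<close> \<open>0 < C\<close> \<open>0 < r\<close> by (simp add: add_pos_pos)
  ultimately have "ln ((r + 1) / (C / t k + r)) < \<beta> * (\<Sum>i=1..k - 1. U i)"
    unfolding E_def by (metis exp_less_cancel_iff exp_ln)
  then show False
    using bound unfolding r_def by simp
qed

theorem lemma3:
  fixes T :: "'t set" and prio :: "'t \<Rightarrow> 'p::linorder" and policy :: "('t, 'j) run set"
    and \<tau> :: "nat \<Rightarrow> 't" and k :: nat
    and t U \<alpha>s \<beta>s :: "nat \<Rightarrow> real" and C \<alpha> \<beta> :: real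
  assumes "2 \<le> k"
    and "fixed_priority_policy T prio policy"
    and "\<tau> k \<in> T"
    and "bij_betw \<tau> {1..k - 1} (higher_priority_tasks T prio (\<tau> k))"
    and "k_point_effective_test policy (\<tau> k) k t C U \<alpha>s \<beta>s"
    and "\<forall>i\<in>{1..k - 1}. 0 < U i \<and> U i \<le> 1"
    and "\<forall>i\<in>{1..k - 1}. 0 < \<alpha>s i \<and> \<alpha>s i \<le> \<alpha>"
    and "\<forall>i\<in>{1..k - 1}. 0 < \<beta>s i \<and> \<beta>s i \<le> \<beta>"
    and "\<beta> * (\<Sum>i=1..k - 1. U i) \<le> ln ((\<alpha> / \<beta> + 1) / (C / t k + \<alpha> / \<beta>))"
  shows "schedulable policy (\<tau> k)"
proof -
  have "\<exists>j\<in>{1..k}. test_succeeds_at k t C U \<alpha>s \<beta>s j"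
    using assms(5-9)
    by (intro test_succeeds_if_log_bound[OF \<open>2 \<le> k\<close>]) (auto simp: k_point_effective_test_def)
  then show ?thesis
    using assms(5) by (simp add: k_point_effective_test_def)
qed

end
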